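(* Let $X$ be a complete length space and let $x\in X$. If there exist positive numbers $k>1$ and $R$ such that $$\pi_1(X)\cong G(x,r,kr)\qquad\text{for all } r>R,$$ then any tangent cone at infinity of $X$ is its own universal cover.
   Context: $B_x(R)$ is the open metric ball and $\overline{B_x(r)}$ the closed metric ball about $x$. For $0<r<R$, $G(x,r,R)$ is the group obtained by taking all loops based at $x$ whose image is contained in $\overline{B_x(r)}$ and identifying two loops if there is a (based) homotopy between them contained in $B_x(R)$. The notation $\pi_1(X)\cong G(x,r,R)$ means that the natural homomorphism $G(x,r,R)\to\pi_1(X,x)$ induced by the inclusion of $\overline{B_x(r)}$ into $X$ is an isomorphism. A pointed length space $(Y,d_Y,y_0)$ is a tangent cone at infinity of a complete length space $(X,d_X)$ if there exist $p\in X$ and a sequence of positive real numbers $r_i\to\infty$ such that the pointed metric spaces $(X,d_X/r_i,p)$ converge in the pointed Gromov–Hausdorff sense to $(Y,d_Y,y_0)$. A path connected covering space $\tilde Y$ of a path connected topological space $Y$ is the universal cover of $Y$ if $\tilde Y$ covers every other path connected cover of $Y$ and the covering projections form a commutative diagram (the universal cover need not be simply connected). "$Y$ is its own universal cover" means that the identity $Y\to Y$ is the universal cover of $Y$.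
   Formalization: The tangent cone at infinity is required to be proper (all closed balls compact), as is customary for pointed Gromov–Hausdorff limits; without this the claim fails, e.g. the plane minus a point would be a tangent cone of the plane. *)

theory Defs
  imports "HOL-Analysis.Analysis" "HOL-Algebra.Group"
begin

section \<open>Length spaces\<close>

definition curve_length :: "(real \<Rightarrow> 'a::metric_space) \<Rightarrow> ennreal" where
  "curve_length g =
     (SUP (n, t) \<in> {(n, t). mono_on {..n} t \<and> t ` {..n} \<subseteq> {0..1}}.
        \<Sum>i<(n::nat). ennreal (dist (g (t i)) (g (t (Suc i)))))"

text \<open>The infimum over the empty set is \<open>\<infinity>\<close>, so a length space is in particular path connected.
  Minimizing curves need not exist.\<close>

definition length_space :: "'a::metric_space itself \<Rightarrow> bool" where
  "length_space _ \<longleftrightarrow>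
     (\<forall>x y :: 'a. ennreal (dist x y) =
        (INF g \<in> {g. path g \<and> pathstart g = x \<and> pathfinish g = y}. curve_length g))"


section \<open>Loops in a set modulo homotopy in a larger set\<close>

definition loops_at :: "'a::topological_space set \<Rightarrow> 'a \<Rightarrow> (real \<Rightarrow> 'a) set" where
  "loops_at A x = {f. path f \<and> path_image f \<subseteq> A \<and> pathstart f = x \<and> pathfinish f = x}"

text \<open>Paths are functions on all of \<open>\<real>\<close> of which only the restriction to \<open>{0..1}\<close> matters;
  \<^const>\<open>homotopic_paths\<close> (homotopy with fixed end points) does not distinguish functions that
  agree there.\<close>

definition loop_rel ::
    "'a::topological_space set \<Rightarrow> 'a set \<Rightarrow> 'a \<Rightarrow> ((real \<Rightarrow> 'a) \<times> (real \<Rightarrow> 'a)) set" where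
  "loop_rel A U x = {(f, g). f \<in> loops_at A x \<and> g \<in> loops_at A x \<and> homotopic_paths U f g}"

definition loop_class ::
    "'a::topological_space set \<Rightarrow> 'a set \<Rightarrow> 'a \<Rightarrow> (real \<Rightarrow> 'a) \<Rightarrow> (real \<Rightarrow> 'a) set" where
  "loop_class A U x f = loop_rel A U x `` {f}"

definition loop_group ::
    "'a::topological_space set \<Rightarrow> 'a set \<Rightarrow> 'a \<Rightarrow> (real \<Rightarrow> 'a) set monoid" where
  "loop_group A U x =
     \<lparr>carrier = loops_at A x // loop_rel A U x,
      mult = (\<lambda>C D. \<Union>f\<in>C. \<Union>g\<in>D. loop_class A U x (f +++ g)),
      one = loop_class A U x (\<lambda>_. x)\<rparr>"

definition fundamental_group :: "'a::topological_space \<Rightarrow> (real \<Rightarrow> 'a) set monoid" where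
  "fundamental_group x = loop_group UNIV UNIV x"

text \<open>The group \<open>G(x, r, R)\<close>, for \<open>0 < r < R\<close>.\<close>

definition ball_loop_group :: "'a::metric_space \<Rightarrow> real \<Rightarrow> real \<Rightarrow> (real \<Rightarrow> 'a) set monoid" where
  "ball_loop_group x r R = loop_group (cball x r) (ball x R) x"

text \<open>Induced by the inclusion of the subspace carrying the loops: the class of \<open>f\<close> is sent to the
  class of \<open>f\<close> in the whole space (see \<open>natural_hom_class\<close> below).\<close>

definition natural_hom ::
    "'a::topological_space \<Rightarrow> (real \<Rightarrow> 'a) set \<Rightarrow> (real \<Rightarrow> 'a) set" where
  "natural_hom x C = (\<Union>f\<in>C. loop_class UNIV UNIV x f)"

lemma equiv_loop_rel:
  assumes "A \<subseteq> U"
  shows "equiv (loops_at A x) (loop_rel A U x)"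
proof (rule equivI)
  show "loop_rel A U x \<subseteq> loops_at A x \<times> loops_at A x"
    by (auto simp: loop_rel_def)
  show "refl_on (loops_at A x) (loop_rel A U x)"
    using assms by (auto simp: refl_on_def loop_rel_def loops_at_def)
  show "sym (loop_rel A U x)"
    by (auto simp: sym_def loop_rel_def homotopic_paths_sym)
  show "trans (loop_rel A U x)"
    by (auto simp: trans_def loop_rel_def intro: homotopic_paths_trans)
qed

lemma loop_class_eq_iff:
  assumes "A \<subseteq> U" "f \<in> loops_at A x" "g \<in> loops_at A x"
  shows "loop_class A U x f = loop_class A U x g \<longleftrightarrow> homotopic_paths U f g"
  using eq_equiv_class_iff[OF equiv_loop_rel[OF assms(1)] assms(2,3)] assms
  by (auto simp: loop_class_def loop_rel_def)

lemma carrier_loop_group: "carrier (loop_group A U x) = loop_class A U x ` loops_at A x"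
  by (auto simp: loop_group_def loop_class_def quotient_def)

lemma loops_at_join: "f \<in> loops_at A x \<Longrightarrow> g \<in> loops_at A x \<Longrightarrow> f +++ g \<in> loops_at A x"
  by (auto simp: loops_at_def path_image_join)

lemma loops_at_reversepath: "f \<in> loops_at A x \<Longrightarrow> reversepath f \<in> loops_at A x"
  by (auto simp: loops_at_def)

lemma loops_at_const: "x \<in> A \<Longrightarrow> (\<lambda>_. x) \<in> loops_at A x"
  by (auto simp: loops_at_def path_def path_image_def pathstart_def pathfinish_def)

lemma mult_loop_class:
  assumes "A \<subseteq> U" "f \<in> loops_at A x" "g \<in> loops_at A x"
  shows "loop_class A U x f \<otimes>\<^bsub>loop_group A U x\<^esub> loop_class A U x g = loop_class A U x (f +++ g)"
proof -
  have "loop_class A U x (f' +++ g') = loop_class A U x (f +++ g)"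
    if "f' \<in> loop_class A U x f" "g' \<in> loop_class A U x g" for f' g'
  proof -
    have *: "f' \<in> loops_at A x" "g' \<in> loops_at A x" "homotopic_paths U f f'" "homotopic_paths U g g'"
      using that by (auto simp: loop_class_def loop_rel_def)
    moreover have "homotopic_paths U (f' +++ g') (f +++ g)"
      by (rule homotopic_paths_join) (use * in \<open>auto simp: homotopic_paths_sym loops_at_def\<close>)
    ultimately show ?thesis
      using assms by (simp add: loop_class_eq_iff loops_at_join)
  qed
  moreover have "f \<in> loop_class A U x f" "g \<in> loop_class A U x g"
    using assms by (auto simp: loop_class_def loop_rel_def loops_at_def)
  ultimately have "(\<Union>f'\<in>loop_class A U x f. \<Union>g'\<in>loop_class A U x g. loop_class A U x (f' +++ g')) =
      loop_class A U x (f +++ g)"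
    by blast
  then show ?thesis
    by (simp add: loop_group_def)
qed

lemma homotopic_join_const:
  assumes "f \<in> loops_at U x"
  shows "homotopic_paths U ((\<lambda>_. x) +++ f) f"
proof -
  have half: "f (2 * t - 1) = x" if "1 \<le> 2 * t" "t * 2 \<le> 1" for t :: real
  proof -
    have "2 * t - 1 = 0"
      using that by simp
    moreover have "f 0 = x"
      using assms by (simp add: loops_at_def pathstart_def)
    ultimately show ?thesis
      by metis
  qed
  have "homotopic_paths U f ((\<lambda>_. x) +++ f)"
  proof (rule homotopic_paths_reparametrize[where f = "\<lambda>t. max 0 (2 * t - 1)"])
    show "continuous_on {0..1} (\<lambda>t::real. max 0 (2 * t - 1))"
      by (intro continuous_intros)
  qed (use assms half in \<open>auto simp: loops_at_def joinpaths_def max_def pathstart_def\<close>)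
  then show ?thesis
    by (rule homotopic_paths_sym)
qed

lemma homotopic_reversepath_join:
  assumes "f \<in> loops_at U x"
  shows "homotopic_paths U (reversepath f +++ f) (\<lambda>_. x)"
proof -
  have f: "continuous_on {0..1} f" "f ` {0..1} \<subseteq> U" "f 0 = x" "f 1 = x"
    using assms by (auto simp: loops_at_def path_def path_image_def pathstart_def pathfinish_def)
  let ?k = "\<lambda>z::real \<times> real. fst z + (1 - fst z) * \<bar>2 * snd z - 1\<bar>"
  have k: "?k ` ({0..1} \<times> {0..1}) \<subseteq> {0..1}"
  proof (rule image_subsetI)
    fix z :: "real \<times> real" assume z: "z \<in> {0..1} \<times> {0..1}"
    then have "(1 - fst z) * \<bar>2 * snd z - 1\<bar> \<le> (1 - fst z) * 1"
      by (intro mult_left_mono) auto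
    moreover have "0 \<le> (1 - fst z) * \<bar>2 * snd z - 1\<bar>"
      using z by (intro mult_nonneg_nonneg) auto
    ultimately show "?k z \<in> {0..1}"
      using z by auto
  qed
  have half: "f (2 * t - 1) = f (1 - 2 * t)" if "\<not> 2 * t < 1" "t * 2 \<le> 1" for t :: real
  proof -
    have "2 * t - 1 = 1 - 2 * t"
      using that by simp
    then show ?thesis
      by metis
  qed
  show ?thesis
    unfolding homotopic_paths
  proof (intro exI[of _ "f \<circ> ?k"] conjI)
    have "continuous_on ({0..1} \<times> {0..1}) ?k"
      by (intro continuous_intros)
    then show "continuous_on ({0..1} \<times> {0..1}) (f \<circ> ?k)"
      by (rule continuous_on_compose) (rule continuous_on_subset[OF f(1) k])
    show "f \<circ> ?k \<in> {0..1} \<times> {0..1} \<rightarrow> U"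
    proof (rule funcsetI)
      fix z :: "real \<times> real" assume "z \<in> {0..1} \<times> {0..1}"
      then have "?k z \<in> {0..1}"
        using k by (rule_tac subsetD[OF k imageI])
      then show "(f \<circ> ?k) z \<in> U"
        using f(2) by (simp only: o_def) blast
    qed
  qed (use f half in \<open>auto simp: reversepath_def joinpaths_def pathstart_def pathfinish_def abs_if\<close>)
qed

lemma group_loop_group:
  assumes "A \<subseteq> U" "x \<in> A"
  shows "group (loop_group A U x)"
proof (rule groupI)
  let ?c = "loop_class A U x"
  have one: "\<one>\<^bsub>loop_group A U x\<^esub> = ?c (\<lambda>_. x)"
    by (simp add: loop_group_def)
  have sub: "f \<in> loops_at U x" if "f \<in> loops_at A x" for f
    using that assms by (auto simp: loops_at_def)
  show "\<one>\<^bsub>loop_group A U x\<^esub> \<in> carrier (loop_group A U x)"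
    using assms by (auto simp: one carrier_loop_group loops_at_const)
  fix C assume "C \<in> carrier (loop_group A U x)"
  then obtain f where f: "f \<in> loops_at A x" "C = ?c f"
    by (auto simp: carrier_loop_group)
  show "\<one>\<^bsub>loop_group A U x\<^esub> \<otimes>\<^bsub>loop_group A U x\<^esub> C = C"
    using assms f
    by (simp add: one mult_loop_class loops_at_const loop_class_eq_iff loops_at_join
        homotopic_join_const sub)
  show "\<exists>D\<in>carrier (loop_group A U x). D \<otimes>\<^bsub>loop_group A U x\<^esub> C = \<one>\<^bsub>loop_group A U x\<^esub>"
  proof (rule bexI)
    show "?c (reversepath f) \<otimes>\<^bsub>loop_group A U x\<^esub> C = \<one>\<^bsub>loop_group A U x\<^esub>"
      using assms f
      by (simp add: one mult_loop_class loops_at_const loop_class_eq_iff loops_at_join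
          loops_at_reversepath homotopic_reversepath_join sub)
  qed (use f in \<open>auto simp: carrier_loop_group loops_at_reversepath\<close>)
  fix D assume "D \<in> carrier (loop_group A U x)"
  then obtain g where g: "g \<in> loops_at A x" "D = ?c g"
    by (auto simp: carrier_loop_group)
  show "C \<otimes>\<^bsub>loop_group A U x\<^esub> D \<in> carrier (loop_group A U x)"
    using assms f g by (auto simp: mult_loop_class carrier_loop_group loops_at_join)
  fix E assume "E \<in> carrier (loop_group A U x)"
  then obtain h where h: "h \<in> loops_at A x" "E = ?c h"
    by (auto simp: carrier_loop_group)
  have "homotopic_paths U (f +++ (g +++ h)) ((f +++ g) +++ h)"
    by (rule homotopic_paths_assoc) (use sub f g h in \<open>auto simp: loops_at_def\<close>)
  then show "C \<otimes>\<^bsub>loop_group A U x\<^esub> D \<otimes>\<^bsub>loop_group A U x\<^esub> E =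
      C \<otimes>\<^bsub>loop_group A U x\<^esub> (D \<otimes>\<^bsub>loop_group A U x\<^esub> E)"
    using assms f g h
    by (simp add: mult_loop_class loops_at_join loop_class_eq_iff homotopic_paths_sym)
qed

lemma natural_hom_class:
  assumes "A \<subseteq> U" "f \<in> loops_at A x"
  shows "natural_hom x (loop_class A U x f) = loop_class UNIV UNIV x f"
proof -
  have "loop_class UNIV UNIV x g = loop_class UNIV UNIV x f" if "g \<in> loop_class A U x f" for g
    using that homotopic_paths_subset[of U f g UNIV]
    by (subst loop_class_eq_iff)
      (auto simp: loop_class_def loop_rel_def loops_at_def homotopic_paths_sym)
  moreover have "f \<in> loop_class A U x f"
    using assms by (auto simp: loop_class_def loop_rel_def loops_at_def)
  ultimately show ?thesis
    unfolding natural_hom_def by blast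
qed

lemma natural_hom_in_hom:
  assumes "A \<subseteq> U"
  shows "natural_hom x \<in> hom (loop_group A U x) (fundamental_group x)"
proof (rule homI)
  have sub: "f \<in> loops_at UNIV x" if "f \<in> loops_at A x" for f
    using that by (auto simp: loops_at_def)
  fix C assume "C \<in> carrier (loop_group A U x)"
  then obtain f where f: "f \<in> loops_at A x" "C = loop_class A U x f"
    by (auto simp: carrier_loop_group)
  then show "natural_hom x C \<in> carrier (fundamental_group x)"
    using assms by (auto simp: fundamental_group_def carrier_loop_group natural_hom_class sub)
  fix D assume "D \<in> carrier (loop_group A U x)"
  then obtain g where g: "g \<in> loops_at A x" "D = loop_class A U x g"
    by (auto simp: carrier_loop_group)
  show "natural_hom x (C \<otimes>\<^bsub>loop_group A U x\<^esub> D) =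
      natural_hom x C \<otimes>\<^bsub>fundamental_group x\<^esub> natural_hom x D"
    using assms f g
    by (simp add: fundamental_group_def mult_loop_class natural_hom_class loops_at_join sub)
qed


section \<open>Tangent cones at infinity\<close>

text \<open>Pointed Gromov--Hausdorff convergence in the form of Burago--Burago--Ivanov: the spaces are
  \<open>('a, d n, p n)\<close> and the limit is \<open>('b, dist, y)\<close>. As usual the limit is required to be
  proper (so complete): Gromov--Hausdorff convergence of balls concerns compact limits, and
  without completeness limits would not even be unique (any dense length subspace containing
  \<open>y\<close> would be a limit too). No properness is required of the approximating spaces.\<close>

definition pointed_GH_convergence ::
    "(nat \<Rightarrow> 'a \<Rightarrow> 'a \<Rightarrow> real) \<Rightarrow> (nat \<Rightarrow> 'a) \<Rightarrow> 'b::metric_space \<Rightarrow> bool" where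
  "pointed_GH_convergence d p y \<longleftrightarrow>
     (\<forall>s. compact (cball y s)) \<and>
     (\<forall>\<rho>>0. \<forall>\<epsilon>>0. \<forall>\<^sub>F n in sequentially. \<exists>f.
        f (p n) = y \<and>
        (\<forall>u v. d n (p n) u < \<rho> \<and> d n (p n) v < \<rho> \<longrightarrow> \<bar>dist (f u) (f v) - d n u v\<bar> < \<epsilon>) \<and>
        (\<forall>z. dist y z < \<rho> - \<epsilon> \<longrightarrow> (\<exists>u. d n (p n) u < \<rho> \<and> dist (f u) z < \<epsilon>)))"

definition tangent_cone_at_infinity :: "'a::metric_space itself \<Rightarrow> 'b::metric_space \<Rightarrow> bool" where
  "tangent_cone_at_infinity _ y \<longleftrightarrow>
     length_space TYPE('b) \<and>
     (\<exists>(p::'a) r. (\<forall>i. 0 < r i) \<and> filterlim r at_top sequentially \<and>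
        pointed_GH_convergence (\<lambda>i u v. dist u v / r i) (\<lambda>_. p) y)"


section \<open>Universal covers\<close>

text \<open>HOL cannot quantify over the types carrying the competing covers, hence the type argument.
  A statement in which \<open>'c\<close> is a free type variable speaks about all covers.\<close>

definition universal_cover ::
    "'c::topological_space itself \<Rightarrow> 'd::topological_space set \<Rightarrow> ('d \<Rightarrow> 'b) \<Rightarrow>
      'b::topological_space set \<Rightarrow> bool" where
  "universal_cover _ E \<pi> Y \<longleftrightarrow>
     path_connected Y \<and> path_connected E \<and> covering_space E \<pi> Y \<and>
     (\<forall>(Z::'c set) q. path_connected Z \<and> covering_space Z q Y \<longrightarrow>
        (\<exists>p. covering_space E p Z \<and> (\<forall>e\<in>E. q (p e) = \<pi> e)))"

definition own_universal_cover ::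
    "'c::topological_space itself \<Rightarrow> 'b::topological_space set \<Rightarrow> bool" where
  "own_universal_cover T Y \<longleftrightarrow> universal_cover T Y id Y"

end

theory Submission
  imports Defs
begin

text \<open>
  For a covering of the tangent cone \<open>Y\<close>, take a path in the total space between two points over
  the base point \<open>y\<close>; it lies over a loop at \<open>y\<close>. The loop is shadowed, at a large scale \<open>r\<close>, by
  a loop at \<open>x\<close> in \<open>X\<close> that stays in a ball of radius \<open>r'\<close> comparable to \<open>r\<close>. Surjectivity of
  \<open>G(x, 2R, 2kR) \<rightarrow> \<pi>\<^sub>1(X)\<close> and injectivity of \<open>G(x, r', kr') \<rightarrow> \<pi>\<^sub>1(X)\<close> give a homotopy inside the
  ball of radius \<open>kr'\<close> to a loop in the ball of radius \<open>2R\<close>, which is negligible at the scale \<open>r\<close>.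
  The Gromov--Hausdorff approximation \<open>X \<rightarrow> Y\<close> is not continuous, so the homotopy is pushed to \<open>Y\<close>
  only on the vertices of a fine grid. This suffices for monodromy: below the Lebesgue number of the
  cover by evenly covered sets, lifting is a matter of finite sequences of points, and the lifts of
  consecutive rows of the grid stay parallel. Hence the original path is closed, the fibre over
  \<open>y\<close> is a single point, and the covering is a homeomorphism.
\<close>

section \<open>Discrete path lifting\<close>

text \<open>\<open>C\<close> relates close points of the base; \<open>E\<close> relates points over close points that lie in the same
  sheet over a small ball.\<close>

locale discrete_covering =
  fixes Z :: "'c set" and q :: "'c \<Rightarrow> 'b" and C :: "'b \<Rightarrow> 'b \<Rightarrow> bool" and E :: "'c \<Rightarrow> 'c \<Rightarrow> bool"
  assumes C_sym: "C a b \<Longrightarrow> C b a"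
    and C_refl: "C a b \<Longrightarrow> C a a"
    and E_close: "E z z' \<Longrightarrow> C (q z) (q z')"
    and E_in: "E z z' \<Longrightarrow> z' \<in> Z"
    and E_sym: "E z z' \<Longrightarrow> E z' z"
    and E_lift: "z \<in> Z \<Longrightarrow> C (q z) b \<Longrightarrow> \<exists>z'. E z z' \<and> q z' = b"
    and E_trans: "E z z' \<Longrightarrow> E z' z'' \<Longrightarrow> C (q z) (q z'') \<Longrightarrow> E z z''"
    and E_unique: "E z z' \<Longrightarrow> q z = q z' \<Longrightarrow> z = z'"
begin

text \<open>\<open>E\<close> is transitive only when the outer points project to
  \<open>C\<close>-related points. The step from index i to i + 1 therefore passes through the
  diagonal pair \<open>w (Suc i)\<close>, \<open>w' i\<close>, which is why closeness along the
  diagonals is assumed.\<close>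

lemma E_parallel:
  assumes "E (w 0) (w' 0)"
    and "\<And>i. i < n \<Longrightarrow> E (w i) (w (Suc i))" "\<And>i. i < n \<Longrightarrow> E (w' i) (w' (Suc i))"
    and "\<And>i. i < n \<Longrightarrow> C (q (w (Suc i))) (q (w' i))"
    and "\<And>i. i < n \<Longrightarrow> C (q (w (Suc i))) (q (w' (Suc i)))"
  shows "i \<le> n \<Longrightarrow> E (w i) (w' i)"
proof (induction i)
  case 0
  then show ?case using assms(1) by simp
next
  case (Suc i)
  then have "E (w (Suc i)) (w' i)"
    using assms(2)[of i] assms(4)[of i] by (meson E_sym E_trans Suc_le_eq Suc_leD)
  then show ?case
    using Suc.prems assms(3)[of i] assms(5)[of i] by (meson E_trans Suc_le_eq)
qed

lemma sequence_lift:
  assumes "z \<in> Z" "v 0 = q z" "\<And>i. i < n \<Longrightarrow> C (v i) (v (Suc i))"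
  shows "\<exists>w. w 0 = z \<and> (\<forall>i\<le>n. w i \<in> Z \<and> q (w i) = v i) \<and> (\<forall>i<n. E (w i) (w (Suc i)))"
  using assms(3)
proof (induction n)
  case 0
  then show ?case using assms(1,2) by (intro exI[of _ "\<lambda>_. z"]) auto
next
  case (Suc n)
  then obtain w where w: "w 0 = z" "\<And>i. i \<le> n \<Longrightarrow> w i \<in> Z \<and> q (w i) = v i"
      "\<And>i. i < n \<Longrightarrow> E (w i) (w (Suc i))"
    by (metis less_SucI)
  obtain z' where z': "E (w n) z'" "q z' = v (Suc n)"
    using E_lift[of "w n" "v (Suc n)"] w(2)[of n] Suc.prems[of n] by auto
  let ?w = "w(Suc n := z')"
  have "?w i \<in> Z \<and> q (?w i) = v i" if "i \<le> Suc n" for i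
    using w(2)[of i] z' E_in[OF z'(1)] that by (auto simp: le_Suc_eq)
  moreover have "E (?w i) (?w (Suc i))" if "i < Suc n" for i
    using w(3)[of i] z' that by (auto simp: less_Suc_eq)
  moreover have "?w 0 = z" using w(1) by simp
  ultimately show ?case by blast
qed

text \<open>Each row is lifted from the same starting point. By \<open>E_parallel\<close> the lifts
  of two consecutive rows remain \<open>E\<close>-related up to their ends, and since both ends lie
  over \<open>a\<close>, \<open>E_unique\<close> makes them equal.\<close>

lemma grid_monodromy:
  assumes "\<And>i. i \<le> n \<Longrightarrow> w i \<in> Z \<and> q (w i) = v 0 i" "\<And>i. i < n \<Longrightarrow> E (w i) (w (Suc i))"
    and "\<And>j. j \<le> m \<Longrightarrow> v j 0 = a" "\<And>j. j \<le> m \<Longrightarrow> v j n = a"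
    and "\<And>j i. j \<le> m \<Longrightarrow> i < n \<Longrightarrow> C (v j i) (v j (Suc i))"
    and "\<And>j i. j < m \<Longrightarrow> i < n \<Longrightarrow> C (v j (Suc i)) (v (Suc j) i)"
    and "\<And>j i. j < m \<Longrightarrow> i \<le> n \<Longrightarrow> C (v j i) (v (Suc j) i)"
  shows "\<exists>w'. w' 0 = w 0 \<and> w' n = w n \<and>
    (\<forall>i\<le>n. w' i \<in> Z \<and> q (w' i) = v m i) \<and> (\<forall>i<n. E (w' i) (w' (Suc i)))"
  using assms(3-7)
proof (induction m)
  case 0
  then show ?case using assms(1,2) by blast
next
  case (Suc m)
  have "\<exists>w'. w' 0 = w 0 \<and> w' n = w n \<and>
      (\<forall>i\<le>n. w' i \<in> Z \<and> q (w' i) = v m i) \<and> (\<forall>i<n. E (w' i) (w' (Suc i)))"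
    by (rule Suc.IH) (use Suc.prems in auto)
  then obtain w1 where w1: "w1 0 = w 0" "w1 n = w n" "\<And>i. i \<le> n \<Longrightarrow> w1 i \<in> Z \<and> q (w1 i) = v m i"
      "\<And>i. i < n \<Longrightarrow> E (w1 i) (w1 (Suc i))"
    by blast
  have ends: "v m 0 = a" "v m n = a" "v (Suc m) 0 = a" "v (Suc m) n = a"
    using Suc.prems(1,2) by auto
  obtain w2 where w2: "w2 0 = w 0" "\<And>i. i \<le> n \<Longrightarrow> w2 i \<in> Z \<and> q (w2 i) = v (Suc m) i"
      "\<And>i. i < n \<Longrightarrow> E (w2 i) (w2 (Suc i))"
    using sequence_lift[of "w 0" "v (Suc m)" n] Suc.prems(3)[of "Suc m"] w1(1,3) ends
    by (metis le0 order_refl)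
  \<comment> \<open>Reflexivity of \<open>E\<close> is not an axiom. It is recovered by lifting
    \<open>a\<close> to a point near \<open>w 0\<close> and identifying that lift with
    \<open>w 0\<close>.\<close>
  have "C a a"
    using Suc.prems(5)[of m 0] ends by simp
  then obtain z' where "E (w 0) z'" "q z' = a"
    using E_lift[of "w 0" a] w1(1) w1(3)[of 0] ends by auto
  then have Ew: "E (w 0) (w 0)"
    using E_unique[of "w 0" z'] w1(1) w1(3)[of 0] ends by auto
  have "E (w1 n) (w2 n)"
    by (rule E_parallel[where n = n and w = w1 and w' = w2 and i = n])
      (use Ew w1 w2 Suc.prems(4)[of m] Suc.prems(5)[of m] in auto)
  then have "w1 n = w2 n"
    by (rule E_unique) (use w1(3)[of n] w2(2)[of n] ends in auto)
  then show ?case using w1(2) w2 by metis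
qed

text \<open>Neither end of the grid is exact: the first row is only close to the loop
  \<open>c\<close>, and the last row only close to the constant \<open>a\<close>. Both gaps are
  bridged by \<open>E_parallel\<close>, and the rows in between by
  \<open>grid_monodromy\<close>.\<close>

lemma closed_lift:
  assumes c: "\<And>i. i \<le> n \<Longrightarrow> w i \<in> Z \<and> q (w i) = c i" "\<And>i. i < n \<Longrightarrow> E (w i) (w (Suc i))" "c n = c 0"
    and ends: "\<And>j. j \<le> m \<Longrightarrow> v j 0 = a" "\<And>j. j \<le> m \<Longrightarrow> v j n = a"
    and grid: "\<And>j i. j \<le> m \<Longrightarrow> i < n \<Longrightarrow> C (v j i) (v j (Suc i))"
      "\<And>j i. j < m \<Longrightarrow> i < n \<Longrightarrow> C (v j (Suc i)) (v (Suc j) i)"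
      "\<And>j i. j < m \<Longrightarrow> i \<le> n \<Longrightarrow> C (v j i) (v (Suc j) i)"
    and first: "\<And>i. i < n \<Longrightarrow> C (c (Suc i)) (v 0 i)" "\<And>i. i \<le> n \<Longrightarrow> C (c i) (v 0 i)"
    and last: "\<And>i. i \<le> n \<Longrightarrow> C (v m i) a"
  shows "w n = w 0"
proof -
  have w0: "w 0 \<in> Z" "q (w 0) = c 0" "q (w n) = c 0"
    using c(1)[of 0] c(1)[of n] c(3) by auto
  obtain z where z: "E (w 0) z" "q z = a" "z \<in> Z"
    using E_lift[of "w 0" a] w0 first(2)[of 0] ends(1)[of 0] E_in by auto
  obtain w1 where w1: "w1 0 = z" "\<And>i. i \<le> n \<Longrightarrow> w1 i \<in> Z \<and> q (w1 i) = v 0 i"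
      "\<And>i. i < n \<Longrightarrow> E (w1 i) (w1 (Suc i))"
    using sequence_lift[of z "v 0" n] z grid(1)[of 0] ends(1)[of 0] by auto
  obtain w2 where w2: "w2 0 = z" "w2 n = w1 n" "\<And>i. i \<le> n \<Longrightarrow> w2 i \<in> Z \<and> q (w2 i) = v m i"
      "\<And>i. i < n \<Longrightarrow> E (w2 i) (w2 (Suc i))"
    using grid_monodromy[of n w1 v m a] w1 ends grid by auto
  have "C a a"
    using last[of 0] ends(1)[of m] by simp
  then have Ez: "E z z"
    using E_lift[of z a] E_unique z by metis
  \<comment> \<open>The lift of the last row runs parallel to the constant sequence
    \<open>z\<close>, so it closes up.\<close>
  have "E (w2 n) z"
    by (rule E_parallel[where n = n and w = w2 and w' = "\<lambda>_. z" and i = n])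
      (use w2 Ez z last in auto)
  then have "w2 n = z"
    by (rule E_unique) (use w2(3)[of n] ends(2)[of m] z in auto)
  moreover have "E (w n) (w1 n)"
    by (rule E_parallel[where n = n and w = w and w' = w1 and i = n])
      (use c w1 z(1) first in auto)
  moreover have "C (c 0) (c 0)"
    using C_refl[OF first(2)[of 0]] by simp
  ultimately have "E (w n) (w 0)"
    using E_trans[of "w n" z "w 0"] E_sym[OF z(1)] w2(2) w0 by auto
  then show ?thesis
    by (rule E_unique) (use w0 in auto)
qed

end


section \<open>Balls and paths in length spaces\<close>

text \<open>The subdivision with the two points 0 and t contributes a single summand to the
  supremum.\<close>

lemma dist_pathstart_le_curve_length:
  assumes "t \<in> {0..1}"
  shows "ennreal (dist (pathstart g) (g t)) \<le> curve_length g"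
proof -
  let ?t = "\<lambda>i::nat. if i = 0 then 0 else t"
  have "(1, ?t) \<in> {(n, t). mono_on {..n} t \<and> t ` {..n} \<subseteq> {0..1}}"
    using assms by (auto simp: mono_on_def)
  then show ?thesis
    unfolding curve_length_def by (rule SUP_upper2) (simp add: pathstart_def)
qed

text \<open>A minimizing curve may not exist, but the infimum yields a curve shorter than
  \<open>L\<close>, and such a curve cannot leave the ball of radius \<open>L\<close> about its
  starting point.\<close>

lemma length_space_near_path:
  fixes a b :: "'a::metric_space"
  assumes "length_space TYPE('a)" "dist a b < L"
  obtains g where "path g" "pathstart g = a" "pathfinish g = b" "path_image g \<subseteq> ball a L"
proof -
  have L: "L > 0" using assms(2) zero_le_dist[of a b] by linarith
  have "(INF g \<in> {g. path g \<and> pathstart g = a \<and> pathfinish g = b}. curve_length g) < ennreal L"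
    using assms L unfolding length_space_def by (metis ennreal_lessI)
  then obtain g where g: "path g" "pathstart g = a" "pathfinish g = b" "curve_length g < ennreal L"
    by (auto simp: INF_less_iff)
  have "dist a (g t) < L" if "t \<in> {0..1}" for t
  proof -
    have "ennreal (dist a (g t)) < ennreal L"
      using dist_pathstart_le_curve_length[OF that, of g] g by (metis order_le_less_trans)
    then show ?thesis using L by (simp add: ennreal_less_iff)
  qed
  then have "path_image g \<subseteq> ball a L" by (auto simp: path_image_def)
  with that g show ?thesis by blast
qed

lemma length_space_path_connected_ball:
  fixes a :: "'a::metric_space"
  assumes "length_space TYPE('a)"
  shows "path_connected (ball a r)"
proof -
  have *: "path_component (ball a r) a b" if "b \<in> ball a r" for b
    using length_space_near_path[OF assms, of a b r] that
    unfolding path_component_def by (metis mem_ball)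
  then show ?thesis
    unfolding path_connected_component by (meson path_component_sym path_component_trans)
qed

lemma length_space_path_connected_UNIV:
  assumes "length_space TYPE('a::metric_space)"
  shows "path_connected (UNIV :: 'a set)"
proof -
  have "path_component UNIV a b" for a b :: 'a
    using length_space_near_path[OF assms, of a b "dist a b + 1"]
    unfolding path_component_def by (metis less_add_one subset_UNIV)
  then show ?thesis
    unfolding path_connected_component by blast
qed

text \<open>Each path gets one unit of parameter, so appending another one leaves the earlier part
  unchanged.\<close>

lemma concatenate_paths:
  fixes g :: "nat \<Rightarrow> real \<Rightarrow> 'a::topological_space"
  assumes "\<And>j. j < n \<Longrightarrow> path (g j) \<and> pathstart (g j) = u j \<and> pathfinish (g j) = u (Suc j)"
  shows "\<exists>h. continuous_on {0..real n} h \<and> h 0 = u 0 \<and> h (real n) = u n \<and>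
    (\<forall>j<n. \<forall>t\<in>{real j..real j + 1}. h t \<in> path_image (g j))"
  using assms
proof (induction n)
  case 0
  then show ?case by (intro exI[of _ "\<lambda>_. u 0"]) auto
next
  case (Suc n)
  then obtain h where h: "continuous_on {0..real n} h" "h 0 = u 0" "h (real n) = u n"
      "\<And>j t. j < n \<Longrightarrow> t \<in> {real j..real j + 1} \<Longrightarrow> h t \<in> path_image (g j)"
    by (metis less_SucI)
  have g: "continuous_on {0..1} (g n)" "g n 0 = u n" "g n 1 = u (Suc n)"
    using Suc.prems[of n] by (auto simp: path_def pathstart_def pathfinish_def)
  let ?h = "\<lambda>t. if t \<le> real n then h t else g n (t - real n)"
  have "continuous_on ({0..real n} \<union> {real n..real n + 1}) ?h"
  proof (rule continuous_on_If)
    show "continuous_on {real n..real n + 1} (\<lambda>t. g n (t - real n))"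
      by (rule continuous_on_compose2[OF g(1)]) (auto intro: continuous_intros)
  qed (use h g in auto)
  moreover have "{0..real n} \<union> {real n..real n + 1} = {0..real (Suc n)}" by auto
  moreover have "?h t \<in> path_image (g j)" if "j < Suc n" "t \<in> {real j..real j + 1}" for j t
  proof (cases "j < n")
    case True
    then have "t \<le> real n" using that by auto
    then show ?thesis using h(4) True that by auto
  next
    case False
    then have j: "j = n" using that by simp
    show ?thesis
    proof (cases "t \<le> real n")
      case True
      then have "t = real n" using that j by auto
      then show ?thesis using h g j by (auto simp: path_image_def intro!: image_eqI[of _ _ 0])
    next
      case False
      then show ?thesis using that j by (auto simp: path_image_def)
    qed
  qed
  moreover have "?h 0 = u 0" "?h (real (Suc n)) = u (Suc n)" using h g by auto
  ultimately show ?case by (intro exI[of _ ?h]) auto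
qed

text \<open>The estimate on the parameter allows the path to be compared later with a loop sampled
  at the times j / n.\<close>

lemma path_through_points:
  fixes u :: "nat \<Rightarrow> 'a::metric_space"
  assumes "length_space TYPE('a)" "n > 0" "\<And>j. j < n \<Longrightarrow> dist (u j) (u (Suc j)) < L"
  obtains g where "path g" "pathstart g = u 0" "pathfinish g = u n"
    "\<And>t. t \<in> {0..1} \<Longrightarrow> \<exists>j<n. \<bar>t - real j / real n\<bar> \<le> 1 / real n \<and> dist (u j) (g t) < L"
proof -
  have "\<forall>j. \<exists>g. j < n \<longrightarrow> path g \<and> pathstart g = u j \<and> pathfinish g = u (Suc j) \<and>
      path_image g \<subseteq> ball (u j) L"
    using length_space_near_path[OF assms(1)] assms(3) by metis
  then obtain G where G: "\<And>j. j < n \<Longrightarrow> path (G j) \<and> pathstart (G j) = u j \<and>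
      pathfinish (G j) = u (Suc j) \<and> path_image (G j) \<subseteq> ball (u j) L"
    by metis
  then obtain h where h: "continuous_on {0..real n} h" "h 0 = u 0" "h (real n) = u n"
      "\<And>j t. j < n \<Longrightarrow> t \<in> {real j..real j + 1} \<Longrightarrow> h t \<in> path_image (G j)"
    using concatenate_paths[of n G u] by metis
  show thesis
  proof (rule that[of "\<lambda>t. h (real n * t)"])
    show "path (\<lambda>t. h (real n * t))"
      unfolding path_def
      by (rule continuous_on_compose2[OF h(1)])
        (use assms(2) in \<open>auto intro!: continuous_intros mult_left_le\<close>)
    fix t :: real assume t: "t \<in> {0..1}"
    \<comment> \<open>At t = 1 the floor would be n, for which there is no segment.\<close>
    define j where "j = (if t = 1 then n - 1 else nat \<lfloor>real n * t\<rfloor>)"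
    have j: "j < n \<and> real j \<le> real n * t \<and> real n * t \<le> real j + 1"
    proof (cases "t = 1")
      case True
      then show ?thesis using assms(2) by (auto simp: j_def of_nat_diff)
    next
      case False
      then have "real n * t < real n" "0 \<le> real n * t" using t assms(2) by auto
      moreover from this have "real j = of_int \<lfloor>real n * t\<rfloor>" using False by (simp add: j_def)
      ultimately show ?thesis by linarith
    qed
    then have "dist (u j) (h (real n * t)) < L"
      using h(4)[of j "real n * t"] G[of j] by auto
    moreover have "\<bar>t - real j / real n\<bar> \<le> 1 / real n"
    proof -
      have "\<bar>real n * t - real j\<bar> / real n \<le> 1 / real n"
        using j by (intro divide_right_mono) auto
      then show ?thesis using assms(2) by (simp add: field_simps abs_le_iff)
    qed
    ultimately show "\<exists>j<n. \<bar>t - real j / real n\<bar> \<le> 1 / real n \<and> dist (u j) (h (real n * t)) < L"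
      using j by blast
  qed (use h in \<open>auto simp: pathstart_def pathfinish_def\<close>)
qed


section \<open>Evenly covered sets\<close>

text \<open>The local condition in \<open>covering_space\<close> is isolated as a property of an
  open set, so that a Lebesgue number can be taken for the family of all such sets.\<close>

definition evenly_covered ::
    "'c::topological_space set \<Rightarrow> ('c \<Rightarrow> 'b) \<Rightarrow> 'b::topological_space set \<Rightarrow> bool" where
  "evenly_covered Z q T \<longleftrightarrow> open T \<and>
     (\<exists>v. \<Union>v = Z \<inter> q -` T \<and> (\<forall>u\<in>v. openin (top_of_set Z) u) \<and> pairwise disjnt v \<and>
          (\<forall>u\<in>v. \<exists>s. homeomorphism u T q s))"

lemma covering_space_evenly_covered:
  assumes "covering_space Z q UNIV"
  obtains T where "b \<in> T" "evenly_covered Z q T"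
proof -
  have "b \<in> UNIV \<longrightarrow> (\<exists>T. b \<in> T \<and> evenly_covered Z q T)"
    using assms unfolding covering_space_def evenly_covered_def subtopology_UNIV open_openin[symmetric]
    by metis
  then show ?thesis using that by blast
qed

text \<open>The sheets are disjoint and open in \<open>Z\<close>, so a connected set over
  \<open>T\<close> lies in a single sheet, where \<open>q\<close> is injective.\<close>

lemma evenly_covered_connected_inj:
  assumes "evenly_covered Z q T" "connected S" "S \<subseteq> Z" "q ` S \<subseteq> T"
  shows "inj_on q S"
proof (cases "S = {}")
  case False
  then obtain z where z: "z \<in> S" by blast
  obtain v where v: "\<Union>v = Z \<inter> q -` T" "\<And>u. u \<in> v \<Longrightarrow> openin (top_of_set Z) u" "pairwise disjnt v"
      "\<And>u. u \<in> v \<Longrightarrow> \<exists>s. homeomorphism u T q s"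
    using assms(1) unfolding evenly_covered_def by auto
  have Sv: "S \<subseteq> \<Union>v" using v(1) assms by auto
  then obtain u where u: "u \<in> v" "z \<in> u" using z by blast
  have restrict: "openin (top_of_set S) (S \<inter> W)" if "openin (top_of_set Z) W" for W
    using that assms(3) by (auto simp: openin_open)
  have "openin (top_of_set S) (S \<inter> u)" "openin (top_of_set S) (S \<inter> \<Union>(v - {u}))"
    using v(2) u(1) restrict openin_Union[of "v - {u}" "top_of_set Z"] by auto
  moreover have "S \<subseteq> (S \<inter> u) \<union> (S \<inter> \<Union>(v - {u}))" using Sv by blast
  moreover have "(S \<inter> u) \<inter> (S \<inter> \<Union>(v - {u})) = {}"
    using v(3) u(1) by (auto simp: pairwise_def disjnt_def)
  ultimately have "S \<inter> \<Union>(v - {u}) = {}"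
    using assms(2) z u(2) unfolding connected_openin by blast
  then have "S \<subseteq> u" using Sv by blast
  moreover have "inj_on q u"
    using v(4)[OF u(1)] by (metis homeomorphism_apply1 inj_on_inverseI)
  ultimately show ?thesis by (rule inj_on_subset[rotated])
qed auto

lemma evenly_covered_section:
  assumes "evenly_covered Z q T" "z \<in> Z" "q z \<in> T"
  obtains s where "continuous_on T s" "s ` T \<subseteq> Z" "s (q z) = z" "\<And>b. b \<in> T \<Longrightarrow> q (s b) = b"
proof -
  obtain v where v: "\<Union>v = Z \<inter> q -` T" "\<And>u. u \<in> v \<Longrightarrow> \<exists>s. homeomorphism u T q s"
    using assms(1) unfolding evenly_covered_def by auto
  then obtain u s where u: "u \<in> v" "z \<in> u" "homeomorphism u T q s"
    using assms by (metis IntI UnionE vimageI)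
  show thesis
  proof (rule that)
    show "s ` T \<subseteq> Z" using u v(1) by (auto simp: homeomorphism_def)
  qed (use u in \<open>auto simp: homeomorphism_def\<close>)
qed

section \<open>Coverings with a one-point fibre\<close>

text \<open>The number of sheets is locally constant, so the points with a one-point fibre form a clopen set.\<close>

lemma covering_space_inj_of_singleton_fibre:
  assumes "covering_space Z q (UNIV :: 'b::topological_space set)" "connected (UNIV :: 'b set)"
    and y: "\<And>z z'. z \<in> Z \<Longrightarrow> z' \<in> Z \<Longrightarrow> q z = y \<Longrightarrow> q z' = y \<Longrightarrow> z = z'"
  shows "inj_on q Z"
proof -
  define P where "P b \<longleftrightarrow> (\<forall>z\<in>Z. \<forall>z'\<in>Z. q z = b \<longrightarrow> q z' = b \<longrightarrow> z = z')" for b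
  \<comment> \<open>Two points over \<open>b'\<close> lie in sheets that each contain a point over
    \<open>b\<close>. These points coincide by \<open>P b\<close>, so the sheets meet and are
    equal.\<close>
  have const: "P b'" if T: "evenly_covered Z q T" "b \<in> T" "b' \<in> T" "P b" for T b b'
    unfolding P_def
  proof (intro ballI impI)
    fix z z' assume z: "z \<in> Z" "z' \<in> Z" "q z = b'" "q z' = b'"
    obtain v where v: "\<Union>v = Z \<inter> q -` T" "\<And>u. u \<in> v \<Longrightarrow> \<exists>s. homeomorphism u T q s"
        "pairwise disjnt v"
      using T(1) unfolding evenly_covered_def by metis
    have "z \<in> \<Union>v" "z' \<in> \<Union>v" using v(1) z T(3) by auto
    then obtain u u' where u: "u \<in> v" "u' \<in> v" "z \<in> u" "z' \<in> u'" by blast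
    obtain s s' where s: "homeomorphism u T q s" "homeomorphism u' T q s'"
      using u v(2) by metis
    have "s b \<in> u" "s' b \<in> u'" "q (s b) = b" "q (s' b) = b"
      using s T(2) by (auto simp: homeomorphism_def)
    moreover from this have "s b \<in> Z" "s' b \<in> Z" using u(1,2) v(1) by blast+
    ultimately have "s b \<in> u \<inter> u'" using T(4) unfolding P_def by (metis IntI)
    then have "u = u'" using u v(3) by (auto simp: pairwise_def disjnt_def)
    then show "z = z'" using s(1) u z by (metis homeomorphism_apply1)
  qed
  have opn: "open {b. Q b}"
    if Q: "\<And>T b b'. evenly_covered Z q T \<Longrightarrow> b \<in> T \<Longrightarrow> b' \<in> T \<Longrightarrow> Q b \<Longrightarrow> Q b'" for Q
  proof (subst open_subopen, rule ballI)
    fix b assume b: "b \<in> {b. Q b}"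
    obtain T where T: "b \<in> T" "evenly_covered Z q T"
      using covering_space_evenly_covered[OF assms(1)] .
    then have "T \<subseteq> {b. Q b}" using Q[OF T(2,1)] b by auto
    then show "\<exists>T. open T \<and> b \<in> T \<and> T \<subseteq> {b. Q b}"
      using T by (auto simp: evenly_covered_def)
  qed
  have "open {b. P b}" "open {b. \<not> P b}"
    using const by (auto intro!: opn)
  moreover have "y \<in> {b. P b}" using y by (auto simp: P_def)
  ultimately have "{b. \<not> P b} = {}"
    using connectedD[OF assms(2), of "{b. P b}" "{b. \<not> P b}"] by auto
  then show ?thesis by (auto intro!: inj_onI simp: P_def)
qed

lemma inj_covering_space_inverse:
  fixes q :: "'c::topological_space \<Rightarrow> 'b::topological_space"
  assumes "covering_space Z q (UNIV :: 'b set)" "inj_on q Z"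
  obtains p where "homeomorphism UNIV Z p q"
proof -
  let ?p = "inv_into Z q"
  have surj: "q ` Z = UNIV" using assms(1) covering_space_imp_surjective by blast
  \<comment> \<open>Over an evenly covered set the inverse agrees with a continuous local
    section.\<close>
  have "continuous_on UNIV ?p"
  proof -
    have "\<exists>T. b \<in> T \<and> open T \<and> continuous_on T ?p" for b
    proof -
      obtain T where T: "b \<in> T" "evenly_covered Z q T"
        using covering_space_evenly_covered[OF assms(1)] .
      obtain z where z: "z \<in> Z" "q z = b" using surj by (metis UNIV_I imageE)
      obtain s where s: "continuous_on T s" "s ` T \<subseteq> Z" "\<And>b. b \<in> T \<Longrightarrow> q (s b) = b"
        using evenly_covered_section[OF T(2) z(1)] z T(1) by metis
      have "?p b' = s b'" if "b' \<in> T" for b'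
        using s that assms(2) by (metis image_subset_iff inv_into_f_f)
      then have "continuous_on T ?p" using s(1) by (metis continuous_on_cong)
      then show ?thesis using T by (auto simp: evenly_covered_def)
    qed
    then obtain T where T: "\<And>b. b \<in> T b \<and> open (T b) \<and> continuous_on (T b) ?p"
      by metis
    then have "continuous_on (\<Union>b. T b) ?p"
      by (intro continuous_on_open_UN) auto
    moreover have "(\<Union>b. T b) = UNIV" using T by blast
    ultimately show ?thesis by simp
  qed
  moreover have "continuous_on Z q" using assms(1) covering_space_imp_continuous by blast
  ultimately have "homeomorphism UNIV Z ?p q"
    using surj assms(2) unfolding homeomorphism_def
    by (auto simp: inv_into_into f_inv_into_f image_iff)
      (metis inv_into_f_f)
  then show thesis by (rule that)
qed

text \<open>This is the relation \<open>E\<close> for an actual covering. A connected set over a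
  small ball stands for "the same sheet", so no evenly covered set or sheet has to be
  chosen.\<close>

definition near :: "'c::topological_space set \<Rightarrow> ('c \<Rightarrow> 'b::metric_space) \<Rightarrow> 'b set \<Rightarrow> real \<Rightarrow> 'c \<Rightarrow> 'c \<Rightarrow> bool"
  where "near Z q K \<delta> z z' \<longleftrightarrow> q z \<in> K \<and> q z' \<in> K \<and> dist (q z) (q z') < \<delta> \<and>
    (\<exists>S\<subseteq>Z. connected S \<and> z \<in> S \<and> z' \<in> S \<and> q ` S \<subseteq> ball (q z) \<delta>)"

text \<open>Lifts exist because balls in a length space are connected, so a local section carries
  them to connected sets. Symmetry and transitivity glue such sets; the union projects into a ball
  of radius 2 \<delta>, hence the doubled radius, and \<open>q\<close> is injective on it.\<close>

lemma near_discrete_covering: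
  fixes q :: "'c::topological_space \<Rightarrow> 'b::metric_space"
  assumes "length_space TYPE('b)" "\<delta> > 0"
    and Leb: "\<And>a. a \<in> K \<Longrightarrow> \<exists>T. evenly_covered Z q T \<and> ball a (2 * \<delta>) \<subseteq> T"
  shows "discrete_covering Z q (\<lambda>a b. a \<in> K \<and> b \<in> K \<and> dist a b < \<delta>) (near Z q K \<delta>)"
proof -
  have inj: "inj_on q S" if S: "connected S" "S \<subseteq> Z" "q ` S \<subseteq> ball a (2 * \<delta>)" "a \<in> K" for S a
    using Leb[OF S(4)] evenly_covered_connected_inj[OF _ S(1,2)] S(3) by (meson subset_trans)
  have lift: "\<exists>z'. near Z q K \<delta> z z' \<and> q z' = b"
    if z: "z \<in> Z" "q z \<in> K" "b \<in> K" "dist (q z) b < \<delta>" for z b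
  proof -
    obtain T where T: "evenly_covered Z q T" "ball (q z) (2 * \<delta>) \<subseteq> T"
      using Leb z(2) by blast
    have B: "ball (q z) \<delta> \<subseteq> T" using T(2) assms(2) by fastforce
    have qz: "q z \<in> ball (q z) \<delta>" "b \<in> ball (q z) \<delta>" using assms(2) z by auto
    obtain s where s: "continuous_on T s" "s ` T \<subseteq> Z" "s (q z) = z" "\<And>b. b \<in> T \<Longrightarrow> q (s b) = b"
      using evenly_covered_section[OF T(1) z(1)] B qz by blast
    let ?S = "s ` ball (q z) \<delta>"
    have "connected (ball (q z) \<delta>)"
      by (rule path_connected_imp_connected[OF length_space_path_connected_ball[OF assms(1)]])
    then have "connected ?S"
      using s(1) B by (metis connected_continuous_image continuous_on_subset)
    moreover have "?S \<subseteq> Z" using s(2) B by blast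
    moreover have "z \<in> ?S" "s b \<in> ?S" using qz s(3) by (auto intro: image_eqI[of _ _ "q z"])
    moreover have "q ` ?S \<subseteq> ball (q z) \<delta>" "q (s b) = b" using s(4) B qz(2) by auto
    ultimately show ?thesis unfolding near_def using z by metis
  qed
  have sym: "near Z q K \<delta> z' z" if n: "near Z q K \<delta> z z'" for z z'
  proof -
    obtain S where S: "S \<subseteq> Z" "connected S" "z \<in> S" "z' \<in> S" "q ` S \<subseteq> ball (q z) \<delta>"
      using n unfolding near_def by blast
    have K: "q z \<in> K" "q z' \<in> K" "dist (q z) (q z') < \<delta>" using n unfolding near_def by auto
    \<comment> \<open>The lift \<open>z0\<close> of \<open>q z\<close> near \<open>z'\<close> is the
      candidate; injectivity on the glued set forces it to be \<open>z\<close>.\<close>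
    obtain z0 where z0: "near Z q K \<delta> z' z0" "q z0 = q z"
      using lift[of z' "q z"] S K by (metis dist_commute subsetD)
    obtain S' where S': "S' \<subseteq> Z" "connected S'" "z' \<in> S'" "z0 \<in> S'" "q ` S' \<subseteq> ball (q z') \<delta>"
      using z0 unfolding near_def by blast
    have "connected (S \<union> S')" using S S' by (intro connected_Un) auto
    moreover have "ball (q z') \<delta> \<subseteq> ball (q z) (2 * \<delta>)" "ball (q z) \<delta> \<subseteq> ball (q z) (2 * \<delta>)"
      using K assms(2) by (auto simp: subset_ball) metric
    then have "q ` (S \<union> S') \<subseteq> ball (q z) (2 * \<delta>)"
      unfolding image_Un Un_subset_iff using S(5) S'(5) by (meson subset_trans)
    ultimately have "inj_on q (S \<union> S')" using inj[of "S \<union> S'"] S(1) S'(1) K(1) by blast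
    then have "z0 = z" using z0 S S' by (auto simp: inj_on_def)
    then show ?thesis using z0 by simp
  qed
  have trans: "near Z q K \<delta> z z''"
    if n: "near Z q K \<delta> z z'" "near Z q K \<delta> z' z''" "dist (q z) (q z'') < \<delta>" for z z' z''
  proof -
    obtain S where S: "S \<subseteq> Z" "connected S" "z \<in> S" "z' \<in> S" "q ` S \<subseteq> ball (q z) \<delta>"
      using n unfolding near_def by blast
    obtain S' where S': "S' \<subseteq> Z" "connected S'" "z' \<in> S'" "z'' \<in> S'" "q ` S' \<subseteq> ball (q z') \<delta>"
      using n unfolding near_def by blast
    have K: "q z \<in> K" "q z'' \<in> K" "dist (q z) (q z') < \<delta>" using n unfolding near_def by auto
    obtain z0 where z0: "near Z q K \<delta> z z0" "q z0 = q z''"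
      using lift[of z "q z''"] S K n by (metis subsetD)
    obtain S0 where S0: "S0 \<subseteq> Z" "connected S0" "z \<in> S0" "z0 \<in> S0" "q ` S0 \<subseteq> ball (q z) \<delta>"
      using z0 unfolding near_def by blast
    have "connected (S \<union> S')" using S S' by (intro connected_Un) auto
    then have "connected (S \<union> S' \<union> S0)" using S S0 by (intro connected_Un[of "S \<union> S'"]) auto
    moreover have "ball (q z') \<delta> \<subseteq> ball (q z) (2 * \<delta>)" "ball (q z) \<delta> \<subseteq> ball (q z) (2 * \<delta>)"
      using K assms(2) by (auto simp: subset_ball) metric
    then have "q ` (S \<union> S' \<union> S0) \<subseteq> ball (q z) (2 * \<delta>)"
      unfolding image_Un Un_subset_iff using S(5) S'(5) S0(5) by (meson subset_trans)
    ultimately have "inj_on q (S \<union> S' \<union> S0)"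
      using inj[of "S \<union> S' \<union> S0"] S(1) S'(1) S0(1) K(1) by blast
    then have "z0 = z''" using z0 S' S0 by (auto simp: inj_on_def)
    then show ?thesis using z0 by simp
  qed
  show ?thesis
  proof unfold_locales
    fix z z' assume n: "near Z q K \<delta> z z'" "q z = q z'"
    then obtain S where S: "S \<subseteq> Z" "connected S" "z \<in> S" "z' \<in> S" "q ` S \<subseteq> ball (q z) \<delta>" "q z \<in> K"
      unfolding near_def by blast
    have "q ` S \<subseteq> ball (q z) (2 * \<delta>)"
      by (rule order_trans[OF S(5) subset_ball]) (use assms(2) in simp)
    then have "inj_on q S" using inj S by blast
    then show "z = z'" using S n by (auto simp: inj_on_def)
  next
    fix z z' assume "near Z q K \<delta> z z'"
    then show "near Z q K \<delta> z' z" by (rule sym)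
  next
    fix z b assume "z \<in> Z" "q z \<in> K \<and> b \<in> K \<and> dist (q z) b < \<delta>"
    then show "\<exists>z'. near Z q K \<delta> z z' \<and> q z' = b" using lift by blast
  next
    fix z z' z''
    assume "near Z q K \<delta> z z'" "near Z q K \<delta> z' z''" "q z \<in> K \<and> q z'' \<in> K \<and> dist (q z) (q z'') < \<delta>"
    then show "near Z q K \<delta> z z''" using trans by blast
  qed (use assms(2) in \<open>auto simp: near_def dist_commute\<close>)
qed


section \<open>Contracting loops towards the base point\<close>

text \<open>Surjectivity at radius \<open>r\<close> supplies \<open>h\<close>, homotopic to
  \<open>g\<close> somewhere in the space. Injectivity at radius \<open>r'\<close> then confines the
  homotopy to the ball of radius \<open>k * r'\<close>.\<close>

lemma homotopic_to_small_loop: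
  fixes x :: "'a::metric_space"
  assumes "k > 1" "R > 0"
    and iso: "\<And>r. r > R \<Longrightarrow> natural_hom x \<in> iso (ball_loop_group x r (k * r)) (fundamental_group x)"
    and "R < r" "r \<le> r'" "g \<in> loops_at (cball x r') x"
  obtains h where "h \<in> loops_at (cball x r) x" "homotopic_paths (ball x (k * r')) g h"
proof -
  have sub: "cball x s \<subseteq> ball x (k * s)" if "s > R" for s
  proof -
    have "s < k * s" using that assms(1,2) by simp
    then show ?thesis by auto
  qed
  let ?c = "\<lambda>s. loop_class (cball x s) (ball x (k * s)) x"
  have bij: "bij_betw (natural_hom x) (?c s ` loops_at (cball x s) x)
      (loop_class UNIV UNIV x ` loops_at UNIV x)" if "s > R" for s
    using iso[OF that] by (simp add: iso_def ball_loop_group_def fundamental_group_def carrier_loop_group)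
  have nat: "natural_hom x (?c s f) = loop_class UNIV UNIV x f"
    if "s > R" "f \<in> loops_at (cball x s) x" for s f
    using natural_hom_class[OF sub[OF that(1)] that(2)] .
  have "g \<in> loops_at UNIV x" using assms(6) by (auto simp: loops_at_def)
  then have "loop_class UNIV UNIV x g \<in> natural_hom x ` ?c r ` loops_at (cball x r) x"
    using bij_betw_imp_surj_on[OF bij[OF assms(4)]] by simp
  then obtain h where h: "h \<in> loops_at (cball x r) x" "natural_hom x (?c r h) = loop_class UNIV UNIV x g"
    by force
  have h': "h \<in> loops_at (cball x r') x" using h(1) assms(5) by (auto simp: loops_at_def)
  have r': "r' > R" using assms by simp
  have "natural_hom x (?c r' g) = natural_hom x (?c r' h)"
    using h nat[OF assms(4) h(1)] nat[OF r' h'] nat[OF r' assms(6)] by simp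
  then have "?c r' g = ?c r' h"
    using bij[OF r'] h' assms(6) by (auto simp: bij_betw_def inj_on_def)
  then have "homotopic_paths (ball x (k * r')) g h"
    using loop_class_eq_iff[OF sub[OF r'] assms(6) h'] by simp
  then show thesis using that h(1) by blast
qed

text \<open>The bound 2 / n covers diagonal neighbours in a square grid of mesh 1 / n.\<close>

lemma uniformly_continuous_at_scale:
  assumes "uniformly_continuous_on S c" "e > 0"
  obtains N :: nat where "N > 0"
    "\<And>n s t. n \<ge> N \<Longrightarrow> s \<in> S \<Longrightarrow> t \<in> S \<Longrightarrow> dist s t \<le> 2 / real n \<Longrightarrow> dist (c s) (c t) < e"
proof -
  obtain d where d: "d > 0" "\<And>s t. s \<in> S \<Longrightarrow> t \<in> S \<Longrightarrow> dist s t < d \<Longrightarrow> dist (c s) (c t) < e"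
    using assms unfolding uniformly_continuous_on_def by (metis dist_commute)
  obtain N :: nat where N: "real N > 2 / d" using reals_Archimedean2 by blast
  then have "N > 0" using d(1) by (metis divide_pos_pos of_nat_0_less_iff order.strict_trans zero_less_numeral)
  moreover have "2 / real n < d" if "n \<ge> N" for n
  proof -
    have "2 / d < real n" using N that by linarith
    then show ?thesis using d(1) \<open>N > 0\<close> that by (simp add: field_simps)
  qed
  ultimately show thesis using that d(2) by (meson le_less_trans)
qed


lemma homotopic_paths_square:
  assumes "homotopic_paths U g h"
  obtains H :: "real \<times> real \<Rightarrow> 'a::topological_space"
  where "continuous_on ({0..1} \<times> {0..1}) H" "H \<in> {0..1} \<times> {0..1} \<rightarrow> U"
    "\<And>t. t \<in> {0..1} \<Longrightarrow> H (0, t) = g t" "\<And>t. t \<in> {0..1} \<Longrightarrow> H (1, t) = h t"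
    "\<And>s. s \<in> {0..1} \<Longrightarrow> H (s, 0) = pathstart g" "\<And>s. s \<in> {0..1} \<Longrightarrow> H (s, 1) = pathfinish g"
proof -
  obtain H :: "real \<times> real \<Rightarrow> 'a"
    where H: "continuous_on ({0..1} \<times> {0..1}) H" "H \<in> {0..1} \<times> {0..1} \<rightarrow> U"
    "\<forall>t\<in>{0..1}. H (0, t) = g t" "\<forall>t\<in>{0..1}. H (1, t) = h t"
    "\<forall>s\<in>{0..1}. pathstart (H \<circ> Pair s) = pathstart g \<and> pathfinish (H \<circ> Pair s) = pathfinish g"
    using assms unfolding homotopic_paths by blast
  show thesis
    by (rule that[OF H(1,2)]) (use H in \<open>auto simp: pathstart_def pathfinish_def\<close>)
qed

section \<open>The fibre over the base point of a tangent cone\<close>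

lemma tangent_cone_singleton_fibre:
  fixes x :: "'a::metric_space" and y :: "'b::metric_space" and k R :: real
    and q :: "'c::topological_space \<Rightarrow> 'b"
  assumes len: "length_space TYPE('a)"
    and "k > 1" and "R > 0"
    and iso: "\<And>r. r > R \<Longrightarrow> natural_hom x \<in> iso (ball_loop_group x r (k * r)) (fundamental_group x)"
    and cone: "tangent_cone_at_infinity TYPE('a) y"
    and cov: "covering_space Z q UNIV" "path_connected Z"
    and z: "z0 \<in> Z" "z1 \<in> Z" "q z0 = y" "q z1 = y"
  shows "z0 = z1"
proof -
  obtain p :: 'a and r where lenY: "length_space TYPE('b)" and r: "\<And>i. 0 < r i" "filterlim r at_top sequentially"
      and GH: "pointed_GH_convergence (\<lambda>i u v. dist u v / r i) (\<lambda>_. p) y"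
    using cone unfolding tangent_cone_at_infinity_def by blast
  obtain w where w: "path w" "path_image w \<subseteq> Z" "pathstart w = z0" "pathfinish w = z1"
    using cov(2) z unfolding path_connected_def by blast
  define c where "c = q \<circ> w"
  have "continuous_on {0..1} w" "w ` {0..1} \<subseteq> Z"
    using w by (auto simp: path_def path_image_def)
  then have c: "continuous_on {0..1} c"
    unfolding c_def using covering_space_imp_continuous[OF cov(1)]
    by (intro continuous_on_compose) (auto intro: continuous_on_subset)
  have c_ends: "c 0 = y" "c 1 = y"
    using w z by (auto simp: c_def pathstart_def pathfinish_def)
  have "bounded (c ` {0..1})"
    using c by (intro compact_imp_bounded compact_continuous_image) auto
  then obtain s where s: "\<And>t. t \<in> {0..1} \<Longrightarrow> dist y (c t) < s"
    unfolding bounded_any_center[of _ y] by (metis image_eqI le_less_trans less_add_one)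
  have "s > 0" using s[of 0] c_ends by simp
  \<comment> \<open>After rescaling, the loop in X will stay within s + 1 of \<open>x\<close> and
    the homotopy within k (s + 1). The additional 1 absorbs the approximation errors and the
    distance from \<open>x\<close> to \<open>p\<close>.\<close>
  define K0 where "K0 = k * (s + 1) + 1"
  have sK: "s + 1 < k * (s + 1)" using \<open>s > 0\<close> \<open>k > 1\<close> by simp
  define K where "K = cball y K0"
  have "compact K" using GH unfolding K_def pointed_GH_convergence_def by blast
  then obtain \<epsilon> where \<epsilon>: "\<epsilon> > 0" "\<And>a. a \<in> K \<Longrightarrow> \<exists>T\<in>Collect (evenly_covered Z q). ball a \<epsilon> \<subseteq> T"
  proof (rule Heine_Borel_lemma)
    show "K \<subseteq> \<Union>(Collect (evenly_covered Z q))"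
      using covering_space_evenly_covered[OF cov(1)] by blast
  qed (auto simp: evenly_covered_def)
  define \<delta> where "\<delta> = min 1 (\<epsilon> / 2)"
  have \<delta>: "0 < \<delta>" "\<delta> \<le> 1" "2 * \<delta> \<le> \<epsilon>" using \<epsilon>(1) by (auto simp: \<delta>_def)
  have "\<exists>T. evenly_covered Z q T \<and> ball a (2 * \<delta>) \<subseteq> T" if "a \<in> K" for a
    using \<epsilon>(2)[OF that] subset_ball[OF \<delta>(3), of a] by blast
  then interpret discrete_covering Z q "\<lambda>a b. a \<in> K \<and> b \<in> K \<and> dist a b < \<delta>" "near Z q K \<delta>"
    by (rule near_discrete_covering[OF lenY \<delta>(1)])
  define e where "e = \<delta> / 40"  \<comment> \<open>all the errors below add up to less than \<open>12 * e\<close>\<close>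
  have e: "0 < e" "40 * e = \<delta>" "40 * e \<le> 1" using \<delta> by (auto simp: e_def)
  define \<rho> where "\<rho> = K0 + 1"
  have "\<rho> > 0" using \<open>s > 0\<close> sK unfolding \<rho>_def K0_def by linarith
  define approx where "approx n f \<longleftrightarrow> f p = y \<and>
      (\<forall>u v. dist p u / r n < \<rho> \<and> dist p v / r n < \<rho> \<longrightarrow> \<bar>dist (f u) (f v) - dist u v / r n\<bar> < e) \<and>
      (\<forall>z. dist y z < \<rho> - e \<longrightarrow> (\<exists>u. dist p u / r n < \<rho> \<and> dist (f u) z < e))" for n and f :: "'a \<Rightarrow> 'b"
  have "\<forall>\<^sub>F n in sequentially. Ex (approx n)"
    using GH e(1) \<open>\<rho> > 0\<close> unfolding pointed_GH_convergence_def approx_def by blast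
  \<comment> \<open>At this scale the ball of radius \<open>2 * R\<close> is negligible, and so is
    the distance between the base point \<open>x\<close> of the loop groups and the base point
    \<open>p\<close> of the cone.\<close>
  moreover have "\<forall>\<^sub>F n in sequentially. max (2 * R) (dist p x) / e < r n"
    using r(2) unfolding filterlim_at_top_dense by blast
  ultimately obtain n f where n: "max (2 * R) (dist p x) / e < r n" and "approx n f"
    using eventually_happens'[OF sequentially_bot eventually_conj] by blast
  then have f0: "f p = y"
    and f1: "\<And>u v. dist p u / r n < \<rho> \<Longrightarrow> dist p v / r n < \<rho> \<Longrightarrow> \<bar>dist (f u) (f v) - dist u v / r n\<bar> < e"
    and f2: "\<And>z. dist y z < \<rho> - e \<Longrightarrow> \<exists>u. dist p u / r n < \<rho> \<and> dist (f u) z < e"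
    unfolding approx_def by blast+
  define D where "D u v = dist u v / r n" for u v :: 'a
  have D_less: "D u v < t \<longleftrightarrow> dist u v < t * r n" for u v t
    using r(1)[of n] by (simp add: D_def pos_divide_less_eq)
  have D_tri: "D u v \<le> D u u' + D u' v" for u v u'
    using r(1)[of n] dist_triangle[of u v u'] by (simp add: D_def divide_right_mono flip: add_divide_distrib)
  have D_com: "D u v = D v u" for u v by (simp add: D_def dist_commute)
  have fD: "\<bar>dist (f u) (f v) - D u v\<bar> < e" if "D p u < \<rho>" "D p v < \<rho>" for u v
    using f1 that by (simp add: D_def)
  have n': "2 * R < e * r n" "D p x < e"
    using n e(1) by (auto simp: pos_divide_less_eq mult.commute D_less)
  have "e < \<rho>" using e sK \<open>s > 0\<close> unfolding \<rho>_def K0_def by linarith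
  then have px: "D p x < \<rho>" "D p p < \<rho>"
    using n'(2) \<open>\<rho> > 0\<close> by (auto simp: D_def)
  have fx: "dist y (f x) < 2 * e"
    using fD[OF px(2,1)] n'(2) f0 by (simp add: abs_less_iff)
  have unif_c: "uniformly_continuous_on {0..1} c"
    using c compact_uniformly_continuous by blast
  obtain M where "M > 0" and unif: "\<And>N t t'. N \<ge> M \<Longrightarrow> t \<in> {0..1} \<Longrightarrow> t' \<in> {0..1} \<Longrightarrow>
      dist t t' \<le> 2 / real N \<Longrightarrow> dist (c t) (c t') < e"
    using uniformly_continuous_at_scale[OF unif_c e(1)] by blast
  note M = \<open>M > 0\<close> unif[OF order_refl]
  have frac: "real j / real M \<in> {0..1}" if "j \<le> M" for j
    using that M(1) by auto
  \<comment> \<open>The samples of \<open>c\<close> are replaced by points of X. At both ends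
    \<open>x\<close> itself serves, with error \<open>2 * e\<close> because \<open>f\<close> sends
    \<open>p\<close>, not \<open>x\<close>, to \<open>y\<close>.\<close>
  have "\<exists>u. D p u < \<rho> \<and> dist (f u) (c (real j / real M)) < 2 * e \<and> (j = 0 \<or> j = M \<longrightarrow> u = x)"
    if "j \<le> M" for j
  proof (cases "j = 0 \<or> j = M")
    case True
    then have "c (real j / real M) = y" using c_ends M(1) by auto
    then show ?thesis using px(1) fx by (auto simp: dist_commute)
  next
    case False
    have "dist y (c (real j / real M)) < \<rho> - e"
      using s[OF frac[OF that]] sK e by (simp add: \<rho>_def K0_def)
    then obtain u where "D p u < \<rho>" "dist (f u) (c (real j / real M)) < e"
      using f2 unfolding D_def by blast
    then show ?thesis using False e(1) by fastforce
  qed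
  then obtain u where u: "\<And>j. j \<le> M \<Longrightarrow> D p (u j) < \<rho>"
      "\<And>j. j \<le> M \<Longrightarrow> dist (f (u j)) (c (real j / real M)) < 2 * e" "u 0 = x" "u M = x"
    by (metis le0 order_refl)
  \<comment> \<open>The errors are 2e + e + 2e in Y and one more e for passing back to X.\<close>
  have "D (u j) (u (Suc j)) < 6 * e" if "j < M" for j
  proof -
    have "dist (real j / real M) (real (Suc j) / real M) \<le> 2 / real M"
      using M(1) by (simp add: dist_real_def divide_simps)
    then have "dist (c (real j / real M)) (c (real (Suc j) / real M)) < e"
      using that frac by (intro M(2)) auto
    moreover have "dist (f (u j)) (c (real j / real M)) < 2 * e"
        "dist (f (u (Suc j))) (c (real (Suc j) / real M)) < 2 * e"
      using u(2)[of j] u(2)[of "Suc j"] that by simp_all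
    ultimately have "dist (f (u j)) (f (u (Suc j))) < 5 * e" by metric
    then show ?thesis using fD[of "u j" "u (Suc j)"] u(1)[of j] u(1)[of "Suc j"] that by simp
  qed
  then obtain g where g: "path g" "pathstart g = x" "pathfinish g = x"
      "\<And>t. t \<in> {0..1} \<Longrightarrow> \<exists>j<M. \<bar>t - real j / real M\<bar> \<le> 1 / real M \<and> dist (u j) (g t) < 6 * e * r n"
    using path_through_points[OF len M(1), of u "6 * e * r n"] u(3,4) by (metis D_less)
  \<comment> \<open>Although \<open>f\<close> need not be continuous, \<open>f\<close> applied to
    \<open>g\<close> follows \<open>c\<close> at every time, not only at the samples.\<close>
  have g_near: "D x (g t) < s + 1 \<and> dist (f (g t)) (c t) < 10 * e" if t: "t \<in> {0..1}" for t
  proof -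
    obtain j where j: "j < M" "\<bar>t - real j / real M\<bar> \<le> 1 / real M" "D (u j) (g t) < 6 * e"
      using g(4)[OF t] D_less by blast
    have uj: "D p (u j) < \<rho>" "dist (f (u j)) (c (real j / real M)) < 2 * e"
      using u j(1) by auto
    have "1 / real M \<le> 2 / real M" by (simp add: divide_right_mono)
    then have "dist t (real j / real M) \<le> 2 / real M"
      using j(2) by (simp add: dist_real_def)
    then have ct: "dist (c t) (c (real j / real M)) < e"
      using frac[of j] j(1) t by (intro M(2)) auto
    have "dist y (f (u j)) < s + 3 * e"
      using ct uj(2) s[OF t] by metric
    then have "D p (u j) < s + 4 * e"
      using fD[OF px(2) uj(1)] f0 by simp
    then have pg: "D p (g t) < s + 10 * e"
      using D_tri[of p "g t" "u j"] j(3) by simp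
    then have "D p (g t) < \<rho>" using e sK by (simp add: \<rho>_def K0_def)
    then have "dist (f (u j)) (f (g t)) < 7 * e"
      using fD[OF uj(1)] j(3) by fastforce
    then have "dist (f (g t)) (c t) < 10 * e"
      using ct uj(2) by metric
    moreover have "D x (g t) < s + 1"
      using D_tri[of x "g t" p] pg n'(2) D_com[of x p] e by simp
    ultimately show ?thesis by blast
  qed
  define L where "L = (s + 1) * r n"
  have "1 * r n \<le> L" "e * r n \<le> 1 * r n"
    unfolding L_def using r(1)[of n] \<open>s > 0\<close> e by (intro mult_right_mono; simp)+
  then have L: "2 * R \<le> L" using n'(1) by simp
  have "g \<in> loops_at (cball x L) x"
    using g(1-3) g_near by (auto simp: loops_at_def path_image_def L_def D_less less_imp_le)
  \<comment> \<open>The hypothesis holds only for radii greater than \<open>R\<close>, hence the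
    radius \<open>2 * R\<close>.\<close>
  then obtain h where h: "h \<in> loops_at (cball x (2 * R)) x" "homotopic_paths (ball x (k * L)) g h"
    using homotopic_to_small_loop[OF \<open>k > 1\<close> \<open>R > 0\<close> iso _ L] \<open>R > 0\<close> by auto
  let ?Q = "{0..1} \<times> {0..1} :: (real \<times> real) set"
  obtain H where H: "continuous_on ?Q H" "H \<in> ?Q \<rightarrow> ball x (k * L)"
      "\<And>t. t \<in> {0..1} \<Longrightarrow> H (0, t) = g t" "\<And>t. t \<in> {0..1} \<Longrightarrow> H (1, t) = h t"
      "\<And>s. s \<in> {0..1} \<Longrightarrow> H (s, 0) = x" "\<And>s. s \<in> {0..1} \<Longrightarrow> H (s, 1) = x"
    using homotopic_paths_square[OF h(2)] g(2,3) by metis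
  \<comment> \<open>The bound on the homotopy keeps it where \<open>f\<close> is almost isometric
    and its image in the compact set \<open>K\<close>.\<close>
  have H_near: "D p (H P) < \<rho> \<and> f (H P) \<in> K" if "P \<in> ?Q" for P
  proof -
    have "dist x (H P) < k * L" using H(2) that by (auto simp: Pi_iff)
    then have "D x (H P) < k * (s + 1)" by (simp add: D_less L_def mult.assoc)
    then have *: "D p (H P) < k * (s + 1) + e"
      using D_tri[of p "H P" x] n'(2) by simp
    then have **: "D p (H P) < \<rho>" using e by (simp add: \<rho>_def K0_def)
    moreover have "dist y (f (H P)) \<le> K0"
      using fD[OF px(2) **] * f0 e by (simp add: K0_def)
    ultimately show ?thesis by (simp add: K_def)
  qed
  have "uniformly_continuous_on ?Q H"
    using H(1) by (intro compact_uniformly_continuous compact_Times) auto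
  then obtain N1 where N1: "\<And>N P P'. N \<ge> N1 \<Longrightarrow> P \<in> ?Q \<Longrightarrow> P' \<in> ?Q \<Longrightarrow> dist P P' \<le> 2 / real N \<Longrightarrow>
      dist (H P) (H P') < e * r n"
    using uniformly_continuous_at_scale[of ?Q H "e * r n"] e(1) r(1)[of n] by (metis mult_pos_pos)
  \<comment> \<open>One mesh serves both the homotopy and the loop \<open>c\<close>.\<close>
  define N where "N = max N1 M"
  have N: "N > 0" "N \<ge> N1" "N \<ge> M" using M(1) by (auto simp: N_def)
  define \<tau> where "\<tau> i = real i / real N" for i
  have \<tau>: "\<tau> i \<in> {0..1}" if "i \<le> N" for i using that N(1) by (auto simp: \<tau>_def)
  have \<tau>_ends: "\<tau> 0 = 0" "\<tau> N = 1" using N(1) by (auto simp: \<tau>_def)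
  have \<tau>_Suc: "\<tau> (Suc i) = \<tau> i + 1 / real N" for i by (simp add: \<tau>_def add_divide_distrib)
  define v where "v j i = f (H (\<tau> j, \<tau> i))" for j i
  \<comment> \<open>Stated for any two vertices of a common cell, this covers horizontal, vertical
    and diagonal neighbours at once.\<close>
  have v_close: "v j i \<in> K \<and> v j' i' \<in> K \<and> dist (v j i) (v j' i') < \<delta>"
    if "j \<le> N" "i \<le> N" "j' \<le> N" "i' \<le> N" "\<bar>\<tau> j - \<tau> j'\<bar> \<le> 1 / real N" "\<bar>\<tau> i - \<tau> i'\<bar> \<le> 1 / real N" for j i j' i'
  proof -
    have P: "(\<tau> j, \<tau> i) \<in> ?Q" "(\<tau> j', \<tau> i') \<in> ?Q" using \<tau> that by auto
    have "dist (\<tau> j, \<tau> i) (\<tau> j', \<tau> i') \<le> \<bar>\<tau> j - \<tau> j'\<bar> + \<bar>\<tau> i - \<tau> i'\<bar>"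
      unfolding dist_Pair_Pair dist_real_def using sqrt_sum_squares_le_sum_abs by (metis abs_abs)
    also have "\<dots> \<le> 2 / real N" using that(5,6) by simp
    finally have "D (H (\<tau> j, \<tau> i)) (H (\<tau> j', \<tau> i')) < e"
      using N1[OF N(2) P] by (simp add: D_less)
    then have "dist (v j i) (v j' i') < 2 * e"
      using fD[of "H (\<tau> j, \<tau> i)" "H (\<tau> j', \<tau> i')"] H_near[OF P(1)] H_near[OF P(2)]
      by (simp add: v_def)
    then show ?thesis using H_near[OF P(1)] H_near[OF P(2)] e by (simp add: v_def)
  qed
  have c_in_K: "c t \<in> K" if "t \<in> {0..1}" for t
    using s[OF that] sK by (simp add: K_def K0_def)
  have c_step: "dist (c t) (c (\<tau> i)) < e" if "i \<le> N" "t \<in> {0..1}" "\<bar>t - \<tau> i\<bar> \<le> 1 / real N" for t i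
  proof -
    have "1 / real N \<le> 2 / real N" by (simp add: divide_right_mono)
    then show ?thesis using unif[OF N(3) that(2) \<tau>[OF that(1)]] that(3) by (simp add: dist_real_def)
  qed
  \<comment> \<open>The connected set required by \<open>near\<close> is the corresponding piece of
    the path \<open>w\<close>.\<close>
  have w_near: "near Z q K \<delta> (w (\<tau> i)) (w (\<tau> (Suc i)))" if i: "i < N" for i
  proof -
    let ?S = "w ` {\<tau> i..\<tau> (Suc i)}"
    have I: "{\<tau> i..\<tau> (Suc i)} \<subseteq> {0..1}" using \<tau>[of i] \<tau>[of "Suc i"] i by auto
    have less: "\<tau> i \<le> \<tau> (Suc i)" by (simp add: \<tau>_Suc)
    have "connected ?S"
      using \<open>continuous_on {0..1} w\<close> I
      by (intro connected_continuous_image) (auto intro: continuous_on_subset)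
    moreover have "?S \<subseteq> Z" using I \<open>w ` {0..1} \<subseteq> Z\<close> by blast
    moreover have "dist (c (\<tau> i)) (c t) < \<delta>" if "t \<in> {\<tau> i..\<tau> (Suc i)}" for t
      using c_step[of i t] that I i e by (auto simp: \<tau>_Suc dist_commute)
    then have "q ` ?S \<subseteq> ball (q (w (\<tau> i))) \<delta>" "dist (q (w (\<tau> i))) (q (w (\<tau> (Suc i)))) < \<delta>"
      using less by (auto simp: c_def)
    moreover have "w (\<tau> i) \<in> ?S" "w (\<tau> (Suc i)) \<in> ?S" using less by auto
    moreover have "q (w (\<tau> i)) \<in> K" "q (w (\<tau> (Suc i))) \<in> K"
      using c_in_K \<tau> i unfolding c_def by (metis Suc_leI comp_apply less_imp_le)+
    ultimately show ?thesis unfolding near_def by blast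
  qed
  \<comment> \<open>A general time \<open>t\<close> is allowed because \<open>closed_lift\<close>
    compares \<open>v 0 i\<close> with \<open>c\<close> at both \<tau> i and \<tau> (i + 1).\<close>
  have cv: "dist (c t) (v 0 i) < \<delta>" "c t \<in> K" "v 0 i \<in> K"
    if "i \<le> N" "t \<in> {0..1}" "\<bar>t - \<tau> i\<bar> \<le> 1 / real N" for t i
  proof -
    have "dist (f (g (\<tau> i))) (c (\<tau> i)) < 10 * e"
      using g_near[OF \<tau>[OF that(1)]] by blast
    then have "dist (v 0 i) (c (\<tau> i)) < 10 * e"
      using \<tau>[OF that(1)] by (simp add: v_def \<tau>_ends H(3))
    then have "dist (c t) (v 0 i) < 11 * e"
      using c_step[OF that] by metric
    then show "dist (c t) (v 0 i) < \<delta>" using e by simp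
  qed (use c_in_K that v_close[of 0 i 0 i] in auto)
  \<comment> \<open>The grid is based at \<open>f x\<close>, which is close to \<open>y\<close> but
    may differ from it. Its last row is the image of the loop \<open>h\<close> in the ball of radius
    \<open>2 * R\<close>, hence close to \<open>f x\<close>.\<close>
  have "w (\<tau> N) = w (\<tau> 0)"
  proof (rule closed_lift[where c = "\<lambda>i. c (\<tau> i)" and v = v and m = N and a = "f x"])
    show "w (\<tau> i) \<in> Z \<and> q (w (\<tau> i)) = c (\<tau> i)" if "i \<le> N" for i
      using \<tau>[OF that] \<open>w ` {0..1} \<subseteq> Z\<close> by (auto simp: c_def)
    show "v j 0 = f x" "v j N = f x" if "j \<le> N" for j
      using H(5,6)[OF \<tau>[OF that]] by (simp_all add: v_def \<tau>_ends)
    fix i assume "i \<le> N"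
    then have hi: "v N i = f (h (\<tau> i))" and Q: "(1, \<tau> i) \<in> ?Q"
      using \<tau>[of i] H(4) by (auto simp: v_def \<tau>_ends)
    have "h (\<tau> i) \<in> cball x (2 * R)"
      using h(1) \<tau>[OF \<open>i \<le> N\<close>] unfolding loops_at_def path_image_def by blast
    then have "D x (h (\<tau> i)) < e" using n'(1) by (simp add: D_less)
    then have "dist (f x) (f (h (\<tau> i))) < 2 * e"
      using fD[OF px(1), of "h (\<tau> i)"] H_near[OF Q] H(4)[of "\<tau> i"] \<tau>[OF \<open>i \<le> N\<close>] by simp
    moreover have "f x \<in> K"
      using fx e sK \<open>s > 0\<close> unfolding K_def K0_def mem_cball by linarith
    ultimately show "v N i \<in> K \<and> f x \<in> K \<and> dist (v N i) (f x) < \<delta>"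
      using hi H_near[OF Q] H(4)[of "\<tau> i"] \<tau>[OF \<open>i \<le> N\<close>] e by (simp add: dist_commute)
  next
    show "c (\<tau> N) = c (\<tau> 0)" by (simp add: \<tau>_ends c_ends)
    show "near Z q K \<delta> (w (\<tau> i)) (w (\<tau> (Suc i)))" if "i < N" for i
      using w_near[OF that] .
    show "v j i \<in> K \<and> v j (Suc i) \<in> K \<and> dist (v j i) (v j (Suc i)) < \<delta>"
      if "j \<le> N" "i < N" for j i
      using that by (intro v_close) (auto simp: \<tau>_Suc)
    show "v j (Suc i) \<in> K \<and> v (Suc j) i \<in> K \<and> dist (v j (Suc i)) (v (Suc j) i) < \<delta>"
      if "j < N" "i < N" for j i
      using that by (intro v_close) (auto simp: \<tau>_Suc)
    show "v j i \<in> K \<and> v (Suc j) i \<in> K \<and> dist (v j i) (v (Suc j) i) < \<delta>"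
      if "j < N" "i \<le> N" for j i
      using that by (intro v_close) (auto simp: \<tau>_Suc)
    show "c (\<tau> (Suc i)) \<in> K \<and> v 0 i \<in> K \<and> dist (c (\<tau> (Suc i))) (v 0 i) < \<delta>" if "i < N" for i
      using cv[of i "\<tau> (Suc i)"] \<tau>[of "Suc i"] that \<tau>_Suc[of i] by simp
    show "c (\<tau> i) \<in> K \<and> v 0 i \<in> K \<and> dist (c (\<tau> i)) (v 0 i) < \<delta>" if "i \<le> N" for i
      using cv[of i "\<tau> i"] \<tau>[of i] that by simp
  qed
  then show ?thesis using w by (simp add: \<tau>_ends pathstart_def pathfinish_def)
qed

theorem theorem1p5:
  fixes x :: "'a::complete_space" and y :: "'b::metric_space" and k R :: real
  assumes "length_space TYPE('a)"
    and "k > 1" and "R > 0"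
    and "\<And>r. r > R \<Longrightarrow> natural_hom x \<in> iso (ball_loop_group x r (k * r)) (fundamental_group x)"
    and "tangent_cone_at_infinity TYPE('a) y"
  shows "own_universal_cover TYPE('c::topological_space) (UNIV :: 'b set)"
proof -
  have "length_space TYPE('b)"
    using assms(5) unfolding tangent_cone_at_infinity_def by blast
  then have pc: "path_connected (UNIV :: 'b set)"
    by (rule length_space_path_connected_UNIV)
  have id: "covering_space UNIV id (UNIV :: 'b set)"
    by (rule homeomorphism_imp_covering_space[of _ _ _ id]) (simp add: homeomorphism_def)
  have "\<exists>p. covering_space UNIV p Z \<and> (\<forall>e\<in>UNIV. q (p e) = id e)"
    if Z: "path_connected Z" "covering_space Z q (UNIV :: 'b set)" for Z :: "'c set" and q
  proof -
    \<comment> \<open>One singleton fibre makes all fibres singletons. Then \<open>q\<close> is a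
      homeomorphism, and its inverse is the covering of \<open>Z\<close> by the base that
      universality demands.\<close>
    have "inj_on q Z"
      using covering_space_inj_of_singleton_fibre[OF Z(2) path_connected_imp_connected[OF pc]]
        tangent_cone_singleton_fibre[OF assms Z(2,1)] by blast
    then obtain p where p: "homeomorphism UNIV Z p q"
      using inj_covering_space_inverse[OF Z(2)] by blast
    then have "covering_space UNIV p Z" by (rule homeomorphism_imp_covering_space)
    moreover have "q (p e) = e" for e using p by (auto simp: homeomorphism_def)
    ultimately show ?thesis by auto
  qed
  then show ?thesis
    unfolding own_universal_cover_def universal_cover_def using pc id by blast
qed

end
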